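(* For a nonnegative integer $n$ let $T_n=\frac{n(n+1)}{2}$. If $K$ and $n$ are nonnegative integers with $T_n\le K<T_{n+1}$, then the maximum number of distinct valid answers among all natural tests with exactly $K$ options is $n$.
   Context: A natural test is a finite multiset of positive integers (its answers, or options, counted with multiplicity; order is irrelevant; the empty test has $0$ options). The number of options is the number of answers counted with multiplicity. A positive integer $a$ is a valid answer of a natural test if $a$ appears in the test exactly $a$ times. *)

theory Defs
  imports Main "HOL-Library.Multiset"
begin

definition triangular :: "nat \<Rightarrow> nat" where
  "triangular n = n * (n + 1) div 2"

definition natural_test :: "nat multiset \<Rightarrow> bool" where
  "natural_test M \<longleftrightarrow> (\<forall>a \<in># M. 0 < a)"

(* The conjunct 0 < a is needed: in a natural test 0 occurs exactly 0 times. *)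
definition valid_answer :: "nat multiset \<Rightarrow> nat \<Rightarrow> bool" where
  "valid_answer M a \<longleftrightarrow> 0 < a \<and> count M a = a"

(* The set below is a subset of set_mset M, so it is finite and card is its true size. *)
definition num_valid_answers :: "nat multiset \<Rightarrow> nat" where
  "num_valid_answers M = card {a. valid_answer M a}"

definition is_maximum :: "'a::linorder \<Rightarrow> 'a set \<Rightarrow> bool" where
  "is_maximum m S \<longleftrightarrow> m \<in> S \<and> (\<forall>x \<in> S. x \<le> m)"

end

theory Submission
  imports Defs
begin

text \<open>
  A valid answer \<open>a\<close> accounts for exactly \<open>a\<close> of the options, and distinct valid answers account
  for different options. Hence the distinct valid answers of a test sum to at most its number of
  options. Among the sets of \<open>k\<close> positive integers the smallest sum is that of \<open>{1, \<dots>, k}\<close>, namely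
  \<open>T\<^sub>k\<close>, so a test with fewer than \<open>T\<^bsub>n+1\<^esub>\<close> options has at most \<open>n\<close> valid answers
  (\<open>triangular_num_valid_answers_le_size\<close>).

  The bound is attained by the test with \<open>a\<close> copies of each \<open>a \<in> {1, \<dots>, n}\<close>, filled up to \<open>K\<close>
  options with copies of \<open>n + 1\<close> (\<open>staircase_test\<close>). The filler has \<open>K - T\<^sub>n \<le> n\<close> copies, too few
  to make \<open>n + 1\<close> valid, and it does not change the multiplicities of \<open>1, \<dots>, n\<close>.
\<close>

lemma sum_atLeast1_eq_triangular: "\<Sum>{1..n} = triangular n"
  using gauss_sum_from_Suc_0[of n, where ?'a = nat] by (simp add: triangular_def)

lemma triangular_mono: "m \<le> n \<Longrightarrow> triangular m \<le> triangular n"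
  unfolding triangular_def by (intro div_le_mono mult_le_mono) simp_all

lemma finite_valid_answers: "finite {a. valid_answer M a}"
  by (rule finite_subset[of _ "set_mset M"]) (auto simp: valid_answer_def simp flip: count_greater_zero_iff)

text \<open>
  Adjoining \<open>0\<close> turns the bound for sets of naturals, whose extremal case is \<open>{0, \<dots>, k - 1}\<close>, into
  the bound for sets of positive integers.
\<close>

lemma triangular_card_le_sum:
  assumes "finite A" "0 \<notin> A"
  shows "triangular (card A) \<le> \<Sum>A"
proof -
  have "\<Sum>{0..<card (insert 0 A)} \<le> \<Sum>(insert 0 A)"
    using assms by (intro card_sum_le_nat_sum)
  moreover have "\<Sum>{0..<card (insert 0 A)} = \<Sum>{1..card A}"
    using assms by (intro sum.mono_neutral_right) auto
  moreover have "\<Sum>(insert 0 A) = \<Sum>A"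
    using assms by simp
  ultimately show ?thesis
    by (simp only: sum_atLeast1_eq_triangular)
qed

lemma triangular_num_valid_answers_le_size: "triangular (num_valid_answers M) \<le> size M"
proof -
  let ?A = "{a. valid_answer M a}"
  have "triangular (num_valid_answers M) \<le> \<Sum>?A"
    unfolding num_valid_answers_def
    by (intro triangular_card_le_sum finite_valid_answers) (simp add: valid_answer_def)
  also have "\<dots> = (\<Sum>a\<in>?A. count M a)"
    by (simp add: valid_answer_def)
  also have "\<dots> \<le> (\<Sum>a\<in>set_mset M. count M a)"
    by (intro sum_mono2) (auto simp: valid_answer_def simp flip: count_greater_zero_iff)
  also have "\<dots> = size M"
    by (simp add: size_multiset_overloaded_eq)
  finally show ?thesis .
qed

definition staircase_test :: "nat \<Rightarrow> nat \<Rightarrow> nat multiset" where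
  "staircase_test n r = (\<Sum>a\<in>{1..n}. replicate_mset a a) + replicate_mset r (n + 1)"

lemma count_staircase_test:
  "count (staircase_test n r) a = (if a \<in> {1..n} then a else if a = n + 1 then r else 0)"
  by (auto simp: staircase_test_def count_sum)

lemma natural_test_staircase_test: "natural_test (staircase_test n r)"
  by (auto simp: natural_test_def count_staircase_test simp flip: count_greater_zero_iff
      split: if_splits)

lemma size_staircase_test: "size (staircase_test n r) = triangular n + r"
  by (simp add: staircase_test_def size_multiset_sum flip: sum_atLeast1_eq_triangular)

lemma num_valid_answers_staircase_test:
  assumes "r \<le> n"
  shows "num_valid_answers (staircase_test n r) = n"
proof -
  have "{a. valid_answer (staircase_test n r) a} = {1..n}"
    using assms by (auto simp: valid_answer_def count_staircase_test split: if_splits)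
  then show ?thesis
    by (simp add: num_valid_answers_def)
qed

theorem proposition10:
  fixes K n :: nat
  assumes "triangular n \<le> K" and "K < triangular (n + 1)"
  shows "is_maximum n {num_valid_answers M | M. natural_test M \<and> size M = K}"
  unfolding is_maximum_def
proof (intro conjI ballI)
  define r where "r = K - triangular n"
  have "triangular (n + 1) = triangular n + (n + 1)"
    by (simp flip: sum_atLeast1_eq_triangular)
  with assms have "r \<le> n" and "triangular n + r = K"
    by (auto simp: r_def)
  then have "num_valid_answers (staircase_test n r) = n" "size (staircase_test n r) = K"
    by (simp_all add: num_valid_answers_staircase_test size_staircase_test)
  then show "n \<in> {num_valid_answers M | M. natural_test M \<and> size M = K}"
    using natural_test_staircase_test[of n r]
    by (intro CollectI exI[of _ "staircase_test n r"]) simp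
next
  fix k
  assume "k \<in> {num_valid_answers M | M. natural_test M \<and> size M = K}"
  then have "triangular k \<le> K"
    using triangular_num_valid_answers_le_size by auto
  with assms(2) have "triangular k < triangular (n + 1)"
    by simp
  then show "k \<le> n"
    using triangular_mono[of "n + 1" k] by linarith
qed

end
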